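(* Let $q$ be a prime power and let $S,\bar S$ be subsets of $\mathbb{F}_q$ with $\sharp S=\sharp\bar S$. Let $f:\mathbb{F}_q\to\mathbb{F}_q$, $g:S\to\bar S$, $\lambda:\mathbb{F}_q\to S$ and $\bar\lambda:\mathbb{F}_q\to\bar S$ be maps such that $\lambda$ and $\bar\lambda$ are surjective and $\bar\lambda\circ f=g\circ\lambda$. Suppose that $f(x)=f_1(x)+h(\lambda(x))$ for all $x\in\mathbb{F}_q$, where $f_1$ is a permutation of $\mathbb{F}_q$ and $h:S\to\mathbb{F}_q$ is a map, and that $f$ is a permutation of $\mathbb{F}_q$ (so that $g$ is a bijection). Let $f_1^{-1}, f^{-1}, g^{-1}$ be the compositional inverses of $f_1,f,g$ respectively. Then for all $x\in\mathbb{F}_q$, $$f^{-1}(x)=f_1^{-1}\left(x-h(g^{-1}(\bar\lambda(x)))\right).$$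
   Context: $\mathbb{F}_q$ is the finite field with $q$ elements. $\sharp X$ denotes cardinality. By the AGW criterion, bijectivity of $f$ implies that $g:S\to\bar S$ is a bijection. *)

theory Defs
  imports "HOL-Number_Theory.Prime_Powers" "HOL-Library.Cardinality"
begin

end

theory Submission
  imports Defs
begin

text \<open>Write \<open>x = f y\<close>. The commuting square gives
  \<open>lam' x = g (lam y)\<close>, so once \<open>g\<close> is invertible, \<open>lam y\<close>
  can be read off from \<open>x\<close> alone. Subtracting \<open>h (lam y)\<close> from
  \<open>x\<close> leaves \<open>f\<^sub>1 y\<close>, and inverting \<open>f\<^sub>1\<close>
  recovers \<open>y\<close>. Invertibility of \<open>g\<close> is a counting matter: it maps onto
  \<open>S'\<close>, a finite set of the same size as \<open>S\<close>.\<close>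

theorem theorem3p2:
  fixes q :: nat
    and S S' :: "'a :: {field, finite} set"
    and f f\<^sub>1 g h lam lam' :: "'a \<Rightarrow> 'a"
  assumes "primepow q"
    and "CARD('a) = q"
    and "card S = card S'"
    and "g ` S \<subseteq> S'"
    and "range lam = S"
    and "range lam' = S'"
    and "lam' \<circ> f = g \<circ> lam"
    and "\<forall>x. f x = f\<^sub>1 x + h (lam x)"
    and "bij f\<^sub>1"
    and "bij f"
  shows "bij_betw g S S' \<and>
    (\<forall>x. inv f x = inv f\<^sub>1 (x - h (inv_into S g (lam' x))))"
proof -
  have comm: "lam' (f x) = g (lam x)" for x
    using fun_cong[OF assms(7), of x] by simp
  \<comment> \<open>Surjectivity of \<open>g\<close> is inherited through the square from that of
    \<open>f\<close> and \<open>lam'\<close>.\<close>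
  have "g ` S = range (lam' \<circ> f)"
    unfolding assms(5)[symmetric] assms(7) by (simp add: image_comp)
  also have "\<dots> = S'"
    using assms(6) bij_is_surj[OF assms(10)] by (metis image_comp)
  finally have img: "g ` S = S'" .
  have inj: "inj_on g S"
    using img assms(3) by (intro eq_card_imp_inj_on) simp_all
  have "inv f x = inv f\<^sub>1 (x - h (inv_into S g (lam' x)))" for x
  proof -
    obtain y where x: "x = f y"
      using bij_is_surj[OF assms(10)] by (rule surjE)
    \<comment> \<open>Cancelling \<open>g\<close> needs \<open>lam y\<close> to lie in
      \<open>S\<close>; rewriting \<open>S\<close> as \<open>range lam\<close> makes this
      immediate.\<close>
    have "inv_into S g (lam' x) = lam y"
      using inj by (simp add: x comm inv_into_f_f flip: assms(5))
    \<comment> \<open>The two \<open>h\<close> terms now have the same argument \<open>lam y\<close>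
      and cancel.\<close>
    then have "x - h (inv_into S g (lam' x)) = f\<^sub>1 y"
      using assms(8) x by simp
    then show ?thesis
      using assms(9,10) x by (simp add: bij_is_inj)
  qed
  then show ?thesis
    using inj img by (simp add: bij_betw_def)
qed

end
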